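(* For $n\geq 1$ let $$t_n(x)=\begin{cases}(1+x)(1-x^2)^{k-1}, & n=2k-1,\\ -(1-x^2)^k, & n=2k.\end{cases}$$ Then for every $n\geq 1$, $$T_n(x)=\frac{x}{1+x}t_n(x)+\sum_{r=2}^n\binom{n}{r-1}t_{n-r+1}(x)T_{r-1}(x).$$ Consequently, the multiplicity of $-1$ as a zero of $T_n(x)$ is $\left\lfloor\frac{n-1}{2}\right\rfloor$.
   Context: A signed permutation $\pi$ in the hyperoctahedral group $\mathcal{B}_n$ is a bijection of $\{\pm1,\ldots,\pm n\}$ with $\pi(-i)=-\pi(i)$, identified with the word $\pi(0)\pi(1)\cdots\pi(n)$, where $\pi(0)=0$. An alternating run of $\pi$ is a maximal consecutive subword (of length at least two) of $\pi(0)\pi(1)\cdots\pi(n)$ that is monotonic in the usual order of integers. $\pi$ is an up signed permutation if $\pi(1)>0$. $T(n,k)$ is the number of up signed permutations in $\mathcal{B}_n$ with exactly $k$ alternating runs, and $T_n(x)=\sum_{k=1}^nT(n,k)x^k$ (type $B$ alternating run polynomials over up signed permutations). E.g. $T_1=x$, $T_2=x+3x^2$, $T_3=x+12x^2+11x^3$. It is known (Zhao) that $T(n,k)=(2k-1)T(n-1,k)+3T(n-1,k-1)+(2n-2k+2)T(n-1,k-2)$ for $n\geq 2$, $1\leq k\leq n$. *)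

theory Defs
  imports
    Complex_Main
    "HOL-Combinatorics.Permutations"
    "HOL-Computational_Algebra.Polynomial_Factorial"
begin

text \<open>
  A signed permutation is a function on all integers that fixes everything outside
  \<open>{-n..n} - {0}\<close>. In particular \<open>\<pi> 0 = 0\<close>, so the associated word
  \<open>\<pi>(0) \<pi>(1) \<dots> \<pi>(n)\<close> is the restriction of \<open>\<pi>\<close> to \<open>{0..n}\<close>.
\<close>

definition signed_perms :: "nat \<Rightarrow> (int \<Rightarrow> int) set" where
  "signed_perms n = {\<pi>. \<pi> permutes ({- int n..int n} - {0}) \<and> (\<forall>i. \<pi> (- i) = - \<pi> i)}"

definition up_signed_perms :: "nat \<Rightarrow> (int \<Rightarrow> int) set" where
  "up_signed_perms n = {\<pi> \<in> signed_perms n. \<pi> 1 > 0}"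

text \<open>
  A consecutive subword \<open>\<pi>(i) \<dots> \<pi>(j)\<close> of \<open>\<pi>(0) \<pi>(1) \<dots> \<pi>(n)\<close> of length at least two
  is represented by the pair \<open>(i, j)\<close> of its end positions.
\<close>

definition monotonic_subwords :: "nat \<Rightarrow> (int \<Rightarrow> int) \<Rightarrow> (int \<times> int) set" where
  "monotonic_subwords n \<pi> =
     {(i, j). 0 \<le> i \<and> i < j \<and> j \<le> int n \<and> (mono_on {i..j} \<pi> \<or> antimono_on {i..j} \<pi>)}"

definition alternating_runs :: "nat \<Rightarrow> (int \<Rightarrow> int) \<Rightarrow> (int \<times> int) set" where
  "alternating_runs n \<pi> =
     {(i, j) \<in> monotonic_subwords n \<pi>.
        \<forall>(i', j') \<in> monotonic_subwords n \<pi>. i' \<le> i \<and> j \<le> j' \<longrightarrow> i' = i \<and> j' = j}"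

definition num_up_runs :: "nat \<Rightarrow> nat \<Rightarrow> nat" where
  "num_up_runs n k = card {\<pi> \<in> up_signed_perms n. card (alternating_runs n \<pi>) = k}"

definition run_poly :: "nat \<Rightarrow> real poly" where
  "run_poly n = (\<Sum>k=1..n. monom (of_nat (num_up_runs n k)) k)"

text \<open>Both for \<open>n = 2 * k\<close> and for \<open>n = 2 * k - 1\<close> the exponent (\<open>k\<close> resp. \<open>k - 1\<close>) is \<open>n div 2\<close>.\<close>

definition t_poly :: "nat \<Rightarrow> real poly" where
  "t_poly n = (if odd n then [:1, 1:] * (1 - [:0, 1:] ^ 2) ^ (n div 2)
               else - ((1 - [:0, 1:] ^ 2) ^ (n div 2)))"

end

theory Submission
  imports Defs
begin

text \<open>
  Write \<open>x\<close> for the variable of the polynomials and \<open>T\<^sub>n\<close> for the run polynomial. Call a signed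
  permutation \<^emph>\<open>aligned\<close> if its word \<open>\<pi>(0) \<dots> \<pi>(n)\<close> moves away from zero in its last step: upwards
  to a positive letter or downwards to a negative one. Let \<open>H\<^sub>n(a)\<close> and \<open>K\<^sub>n(a)\<close> be the sums of
  \<open>x\<close> to the number of runs over the aligned and the non-aligned up signed permutations whose
  last letter has absolute value \<open>a\<close>.

  Every up signed permutation of size \<open>n + 1\<close> arises in one way by appending a letter \<open>v\<close>,
  \<open>|v| = a\<close>, to one of size \<open>n\<close> with last letter \<open>w\<close>, after enlarging by one the absolute values
  that are at least \<open>a\<close>. If \<open>|w| < a\<close>, both signs of \<open>v\<close> give an aligned permutation and exactly
  one of them starts a new run; if \<open>|w| \<ge> a\<close>, one sign gives an aligned permutation and the
  other a non-aligned one, and both start a new run exactly if the old permutation is aligned.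
  The recurrence for \<open>H\<^sub>n\<^sub>+\<^sub>1(a)\<close> and \<open>K\<^sub>n\<^sub>+\<^sub>1(a)\<close> that follows (\<open>layer_Suc\<close>) has three consequences:
  \<^item> at the bottom, \<open>H\<^sub>n\<^sub>+\<^sub>1(1) = K\<^sub>n\<^sub>+\<^sub>1(1)\<close> for \<open>n \<ge> 1\<close>;
  \<^item> at the top, \<open>H\<^sub>n\<^sub>+\<^sub>1(n + 1) = (1 + x) T\<^sub>n\<close> and \<open>K\<^sub>n\<^sub>+\<^sub>1(n + 1) = 0\<close>, where \<open>(1 + x) T\<^sub>0\<close> is to be
    read as \<open>x\<close>;
  \<^item> the vector \<open>V = (H, K)\<close> satisfies \<open>V\<^sub>n\<^sub>+\<^sub>1(a + 1) - V\<^sub>n\<^sub>+\<^sub>1(a) = M V\<^sub>n(a)\<close> for the matrix \<open>M\<close> with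
    rows \<open>(1, x)\<close> and \<open>(-x, -1)\<close>.

  Iterating the last relation from \<open>a = 1\<close> to the top expresses \<open>V\<^sub>n\<^sub>+\<^sub>1(1)\<close> as the sum of
  \<open>binom(n, i) (-M)\<^sup>i V\<^sub>n\<^sub>+\<^sub>1\<^sub>-\<^sub>i(n + 1 - i)\<close>. Since \<open>M\<^sup>2 = (1 - x\<^sup>2) I\<close>, the row vector \<open>(1, -1) (-M)\<^sup>i\<close>
  is \<open>(-t\<^sub>i, (-1)\<^sup>i t\<^sub>i)\<close>, and the bottom relation turns the sum into
  \<open>0 = \<Sum> binom(n, i) t\<^sub>i (1 + x) T\<^sub>n\<^sub>-\<^sub>i\<close>. As \<open>t\<^sub>0 = -1\<close>, this is the claimed convolution.

  For the multiplicity, \<open>t\<^sub>m\<close> is divisible by \<open>1 + x\<close> exactly \<open>\<lceil>m/2\<rceil>\<close> times, so by induction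
  \<open>(1 + x) T\<^sub>n = (1 + x)^\<lceil>n/2\<rceil> R\<^sub>n\<close> for a polynomial \<open>R\<^sub>n\<close>. The convolution gives a recurrence for
  the values \<open>R\<^sub>n(-1)\<close>, from which \<open>R\<^sub>n(-1)\<close> is \<open>2^\<lfloor>n/2\<rfloor>\<close> times an integer that is odd because
  \<open>2\<^sup>n - 1\<close> is. These odd integers are Euler numbers up to sign.
\<close>

section \<open>Counting runs by their end positions\<close>

definition ascent :: "(int \<Rightarrow> int) \<Rightarrow> int \<Rightarrow> bool" where
  "ascent \<pi> k \<longleftrightarrow> \<pi> (k - 1) < \<pi> k"

definition run_ends :: "nat \<Rightarrow> (int \<Rightarrow> int) \<Rightarrow> int set" where
  "run_ends n \<pi> = {j. 1 \<le> j \<and> j \<le> int n \<and> (j = int n \<or> ascent \<pi> j \<noteq> ascent \<pi> (j + 1))}"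

text \<open>Only neighbours need to be compared, so runs can be read off the sequence of ascents.\<close>

lemma mono_on_int_interval_iff:
  fixes f :: "int \<Rightarrow> int"
  shows "mono_on {i..j} f \<longleftrightarrow> (\<forall>k\<in>{i<..j}. f (k - 1) \<le> f k)"
proof
  assume "mono_on {i..j} f"
  then show "\<forall>k\<in>{i<..j}. f (k - 1) \<le> f k"
    by (auto simp: monotone_on_def)
next
  assume step: "\<forall>k\<in>{i<..j}. f (k - 1) \<le> f k"
  show "mono_on {i..j} f"
  proof (rule mono_onI)
    fix r s assume rs: "r \<in> {i..j}" "s \<in> {i..j}" "r \<le> s"
    have "s \<le> j \<longrightarrow> f r \<le> f s"
      using \<open>r \<le> s\<close>
    proof (induction s rule: int_ge_induct)
      case (step s)
      then show ?case
        using \<open>r \<in> {i..j}\<close> \<open>\<forall>k\<in>{i<..j}. f (k - 1) \<le> f k\<close>[rule_format, of "s + 1"] by auto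
    qed simp
    then show "f r \<le> f s" using rs by simp
  qed
qed

lemma antimono_on_int_interval_iff:
  fixes f :: "int \<Rightarrow> int"
  shows "antimono_on {i..j} f \<longleftrightarrow> (\<forall>k\<in>{i<..j}. f k \<le> f (k - 1))"
  using mono_on_int_interval_iff[of i j "\<lambda>k. - f k"] by (simp add: monotone_on_def)

lemma monotonic_subwords_iff:
  assumes "inj \<pi>"
  shows "(i, j) \<in> monotonic_subwords n \<pi> \<longleftrightarrow>
    0 \<le> i \<and> i < j \<and> j \<le> int n \<and> (\<forall>k\<in>{i<..j}. ascent \<pi> k = ascent \<pi> j)"
proof -
  have ne: "\<pi> (k - 1) \<noteq> \<pi> k" for k using injD[OF assms, of "k - 1" k] by auto
  have "mono_on {i..j} \<pi> \<longleftrightarrow> (\<forall>k\<in>{i<..j}. ascent \<pi> k)"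
    unfolding mono_on_int_interval_iff ascent_def using ne by (auto simp: order_le_less)
  moreover have "antimono_on {i..j} \<pi> \<longleftrightarrow> (\<forall>k\<in>{i<..j}. \<not> ascent \<pi> k)"
    unfolding antimono_on_int_interval_iff ascent_def by (auto simp: not_less)
  moreover have "(\<forall>k\<in>{i<..j}. ascent \<pi> k) \<or> (\<forall>k\<in>{i<..j}. \<not> ascent \<pi> k) \<longleftrightarrow>
    (\<forall>k\<in>{i<..j}. ascent \<pi> k = ascent \<pi> j)" if "i < j"
    using that by (metis greaterThanAtMost_iff order_refl)
  ultimately show ?thesis
    unfolding monotonic_subwords_def by blast
qed

text \<open>
  Two runs with the same end are nested, hence equal by maximality. Conversely the longest
  monotonic subword that ends at a turning point (or at \<open>n\<close>) cannot be extended to the right.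
\<close>

lemma bij_betw_alternating_runs_run_ends:
  assumes "inj \<pi>"
  shows "bij_betw snd (alternating_runs n \<pi>) (run_ends n \<pi>)"
proof (rule bij_betw_imageI)
  note iff = monotonic_subwords_iff[OF assms, of _ _ n]
  show "inj_on snd (alternating_runs n \<pi>)"
  proof (rule inj_onI, clarsimp)
    fix i i' j assume "(i, j) \<in> alternating_runs n \<pi>" "(i', j) \<in> alternating_runs n \<pi>"
    then show "i = i'"
      unfolding alternating_runs_def by (cases "i \<le> i'") force+
  qed
  show "snd ` alternating_runs n \<pi> = run_ends n \<pi>"
  proof (intro equalityI subsetI)
    fix j assume "j \<in> snd ` alternating_runs n \<pi>"
    then obtain i where run: "(i, j) \<in> monotonic_subwords n \<pi>"
      and max: "\<And>i' j'. (i', j') \<in> monotonic_subwords n \<pi> \<Longrightarrow> i' \<le> i \<Longrightarrow> j \<le> j' \<Longrightarrow> j' = j"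
      unfolding alternating_runs_def by fastforce
    have "j = int n \<or> ascent \<pi> j \<noteq> ascent \<pi> (j + 1)"
    proof (rule ccontr)
      assume neg: "\<not> ?thesis"
      have "ascent \<pi> k = ascent \<pi> (j + 1)" if "k \<in> {i<..j + 1}" for k
      proof -
        have "k = j + 1 \<or> k \<in> {i<..j}" using that by auto
        then show ?thesis using neg run unfolding iff by metis
      qed
      moreover have "0 \<le> i \<and> i < j + 1 \<and> j + 1 \<le> int n"
        using run neg by (auto simp: monotonic_subwords_def)
      ultimately have "(i, j + 1) \<in> monotonic_subwords n \<pi>"
        unfolding iff by blast
      then show False using max[of i "j + 1"] by simp
    qed
    moreover have "0 \<le> i" "i < j" "j \<le> int n" using run unfolding iff by blast+
    ultimately show "j \<in> run_ends n \<pi>"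
      unfolding run_ends_def by auto
  next
    fix j assume j: "j \<in> run_ends n \<pi>"
    define I where "I = {i. (i, j) \<in> monotonic_subwords n \<pi>}"
    have "I \<subseteq> {0..j}" by (auto simp: I_def monotonic_subwords_def)
    then have fin: "finite I" by (rule finite_subset) simp
    have "{j - 1<..j} = {j}" by auto
    then have "j - 1 \<in> I"
      unfolding I_def iff using j by (auto simp: run_ends_def)
    then have Min: "Min I \<in> I" using fin by (intro Min_in) auto
    have "(Min I, j) \<in> alternating_runs n \<pi>"
      unfolding alternating_runs_def
    proof (clarify, intro conjI)
      show run: "(Min I, j) \<in> monotonic_subwords n \<pi>" using Min unfolding I_def by simp
      show "\<forall>(i', j')\<in>monotonic_subwords n \<pi>. i' \<le> Min I \<and> j \<le> j' \<longrightarrow> i' = Min I \<and> j' = j"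
      proof clarify
        fix i' j' assume sup: "(i', j') \<in> monotonic_subwords n \<pi>" "i' \<le> Min I" "j \<le> j'"
        have lt: "Min I < j" using run by (simp add: monotonic_subwords_def)
        have same: "ascent \<pi> k = ascent \<pi> j'" if "k \<in> {i'<..j'}" for k
          using sup(1) that unfolding iff by blast
        have "j' = j"
        proof (rule ccontr)
          assume "j' \<noteq> j"
          then have "ascent \<pi> j = ascent \<pi> (j + 1)"
            using same[of j] same[of "j + 1"] sup lt by auto
          moreover have "j \<noteq> int n" using \<open>j' \<noteq> j\<close> sup by (auto simp: monotonic_subwords_def)
          ultimately show False using j unfolding run_ends_def by simp
        qed
        moreover from this have "i' \<in> I" using sup unfolding I_def by simp
        then have "Min I \<le> i'" using fin by simp
        ultimately show "i' = Min I \<and> j' = j" using sup by simp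
      qed
    qed
    then show "j \<in> snd ` alternating_runs n \<pi>" by force
  qed
qed

lemma card_alternating_runs: "inj \<pi> \<Longrightarrow> card (alternating_runs n \<pi>) = card (run_ends n \<pi>)"
  by (rule bij_betw_same_card[OF bij_betw_alternating_runs_run_ends])

lemma finite_run_ends: "finite (run_ends n \<pi>)"
  by (rule finite_subset[of _ "{1..int n}"]) (auto simp: run_ends_def)

lemma card_run_ends_bounds:
  assumes "n \<ge> 1"
  shows "1 \<le> card (run_ends n \<pi>)" "card (run_ends n \<pi>) \<le> n"
proof -
  have "int n \<in> run_ends n \<pi>" using assms by (simp add: run_ends_def)
  then show "1 \<le> card (run_ends n \<pi>)"
    using finite_run_ends card_gt_0_iff[of "run_ends n \<pi>"] by (auto simp: Suc_le_eq)
  have "card (run_ends n \<pi>) \<le> card {1..int n}"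
    by (rule card_mono) (auto simp: run_ends_def)
  then show "card (run_ends n \<pi>) \<le> n" by simp
qed

text \<open>
  Lengthening the word adds the run end \<open>n + 1\<close>; the run end \<open>n\<close> survives exactly if the word
  turns there.
\<close>

lemma card_run_ends_Suc:
  assumes n: "n \<ge> 1" and same: "\<And>k. 1 \<le> k \<Longrightarrow> k \<le> int n \<Longrightarrow> ascent \<pi> k = ascent \<sigma> k"
  shows "card (run_ends (Suc n) \<pi>) =
    card (run_ends n \<sigma>) + (if ascent \<pi> (int n) = ascent \<pi> (int n + 1) then 0 else 1)"
proof -
  have mem: "int n \<in> run_ends n \<sigma>" using n by (simp add: run_ends_def)
  have notin: "int n + 1 \<notin> run_ends n \<sigma>" by (simp add: run_ends_def)
  have rec: "run_ends (Suc n) \<pi> = insert (int n + 1)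
      (if ascent \<pi> (int n) = ascent \<pi> (int n + 1) then run_ends n \<sigma> - {int n} else run_ends n \<sigma>)"
  proof (rule set_eqI)
    fix j :: int
    consider "j < 1 \<or> j > int n + 1" | "j = int n + 1" | "j = int n" | "1 \<le> j" "j < int n" by linarith
    then show "j \<in> run_ends (Suc n) \<pi> \<longleftrightarrow> j \<in> insert (int n + 1)
      (if ascent \<pi> (int n) = ascent \<pi> (int n + 1) then run_ends n \<sigma> - {int n} else run_ends n \<sigma>)"
    proof cases
      case 4
      then show ?thesis using same[of j] same[of "j + 1"] by (auto simp: run_ends_def)
    qed (use n in \<open>auto simp: run_ends_def\<close>)
  qed
  show ?thesis
    unfolding rec using notin mem finite_run_ends[of n \<sigma>] card_run_ends_bounds(1)[OF n, of \<sigma>]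
    by (auto simp: card_insert_if)
qed

section \<open>Appending a letter to a signed permutation\<close>

lemma signed_perms_inj: "\<pi> \<in> signed_perms n \<Longrightarrow> inj \<pi>"
  by (auto simp: signed_perms_def permutes_inj)

lemma finite_up_signed_perms: "finite (up_signed_perms n)"
  by (rule finite_subset[OF _ finite_permutations[of "{- int n..int n} - {0}"]])
     (auto simp: up_signed_perms_def signed_perms_def)

lemma signed_perms_range:
  assumes "\<pi> \<in> signed_perms n" "i \<noteq> 0" "\<bar>i\<bar> \<le> int n"
  shows "\<pi> i \<noteq> 0" "\<bar>\<pi> i\<bar> \<le> int n"
proof -
  have "\<pi> i \<in> {- int n..int n} - {0}"
    using assms permutes_in_image[of \<pi> "{- int n..int n} - {0}" i] by (auto simp: signed_perms_def)
  then show "\<pi> i \<noteq> 0" "\<bar>\<pi> i\<bar> \<le> int n" by auto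
qed

definition run_weight :: "nat \<Rightarrow> (int \<Rightarrow> int) \<Rightarrow> real poly" where
  "run_weight n \<pi> = [:0, 1:] ^ card (run_ends n \<pi>)"

lemma run_poly_eq_sum_weight:
  assumes "n \<ge> 1"
  shows "run_poly n = (\<Sum>\<pi>\<in>up_signed_perms n. run_weight n \<pi>)"
proof -
  have inj: "inj \<pi>" if "\<pi> \<in> up_signed_perms n" for \<pi>
    using that signed_perms_inj by (auto simp: up_signed_perms_def)
  have "(\<Sum>\<pi>\<in>up_signed_perms n. run_weight n \<pi>) =
    (\<Sum>k=1..n. \<Sum>\<pi>\<in>{\<pi> \<in> up_signed_perms n. card (run_ends n \<pi>) = k}. run_weight n \<pi>)"
    by (rule sum.group[symmetric]) (use finite_up_signed_perms card_run_ends_bounds[OF assms] in auto)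
  also have "\<dots> = run_poly n"
    unfolding run_poly_def
  proof (rule sum.cong[OF refl])
    fix k
    have "(\<Sum>\<pi>\<in>{\<pi> \<in> up_signed_perms n. card (run_ends n \<pi>) = k}. run_weight n \<pi>) =
      of_nat (card {\<pi> \<in> up_signed_perms n. card (run_ends n \<pi>) = k}) * [:0, 1:] ^ k"
      by (simp add: run_weight_def)
    moreover have "{\<pi> \<in> up_signed_perms n. card (run_ends n \<pi>) = k} =
      {\<pi> \<in> up_signed_perms n. card (alternating_runs n \<pi>) = k}"
      using inj by (auto simp: card_alternating_runs)
    ultimately show "(\<Sum>\<pi>\<in>{\<pi> \<in> up_signed_perms n. card (run_ends n \<pi>) = k}. run_weight n \<pi>) =
        monom (of_nat (num_up_runs n k)) k"
      by (simp add: num_up_runs_def monom_altdef of_nat_poly)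
  qed
  finally show ?thesis ..
qed

definition last_letters :: "nat \<Rightarrow> int set" where
  "last_letters n = {- int (Suc n)..int (Suc n)} - {0}"

text \<open>
  This signed permutation of \<open>{-n - 1..n + 1}\<close> sends \<open>n + 1\<close> to \<open>v\<close> and maps \<open>{-n..n}\<close> increasingly onto
  what is left. Composing with it, instead of editing words, keeps the group structure at hand:
  it makes appending a letter invertible.
\<close>

definition make_room :: "nat \<Rightarrow> int \<Rightarrow> int \<Rightarrow> int" where
  "make_room n v y =
     (if \<bar>y\<bar> \<le> int n then (if \<bar>y\<bar> < \<bar>v\<bar> then y else y + sgn y)
      else if y = int n + 1 then v else if y = - int n - 1 then - v else y)"

lemma make_room_in_signed_perms:
  assumes "v \<in> last_letters n"
  shows "make_room n v \<in> signed_perms (Suc n)"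
proof -
  let ?S = "{- int (Suc n)..int (Suc n)} - {0}"
  \<comment> \<open>the inverse map, which closes the gap at the absolute value of \<open>v\<close>\<close>
  let ?close = "\<lambda>z. if \<bar>z\<bar> < \<bar>v\<bar> then z else if z = v then int n + 1
    else if z = - v then - int n - 1 else z - sgn z"
  have v: "v \<noteq> 0" "\<bar>v\<bar> \<le> int n + 1" using assms by (auto simp: last_letters_def)
  have cases: "?close (make_room n v y) = y \<and> make_room n v y \<in> ?S" if "y \<in> ?S" for y
  proof -
    have "y \<noteq> 0" "- int n - 1 \<le> y" "y \<le> int n + 1" using that by auto
    then consider "\<bar>y\<bar> \<le> int n" "\<bar>y\<bar> < \<bar>v\<bar>" | "\<bar>y\<bar> \<le> int n" "\<bar>v\<bar> \<le> \<bar>y\<bar>" "0 < y"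
      | "\<bar>y\<bar> \<le> int n" "\<bar>v\<bar> \<le> \<bar>y\<bar>" "y < 0" | "y = int n + 1" | "y = - int n - 1"
      by atomize_elim arith
    then show ?thesis
      using v \<open>y \<in> ?S\<close> by cases (auto simp: make_room_def)
  qed
  have inj: "inj_on (make_room n v) ?S"
    by (rule inj_on_inverseI[where g = ?close, OF cases[THEN conjunct1]])
  have maps: "make_room n v ` ?S \<subseteq> ?S"
    by (rule image_subsetI[OF cases[THEN conjunct2]])
  have outside: "make_room n v y = y" if "y \<notin> ?S" for y
  proof -
    have "y = 0 \<or> int n + 1 < y \<or> y < - int n - 1" using that by auto
    then show ?thesis using v by (auto simp: make_room_def)
  qed
  have "make_room n v permutes ?S"
  proof (rule bij_imp_permutes)
    show "bij_betw (make_room n v) ?S ?S"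
      using inj maps by (simp add: bij_betw_def endo_inj_surj)
  qed (rule outside)
  moreover have "make_room n v (- i) = - make_room n v i" for i
    by (auto simp: make_room_def)
  ultimately show ?thesis by (simp add: signed_perms_def)
qed

lemma signed_perms_compose:
  "\<pi> \<in> signed_perms n \<Longrightarrow> \<sigma> \<in> signed_perms n \<Longrightarrow> \<pi> \<circ> \<sigma> \<in> signed_perms n"
  by (auto simp: signed_perms_def permutes_compose)

lemma signed_perms_inv: 
  assumes "\<pi> \<in> signed_perms n" shows "inv \<pi> \<in> signed_perms n"
proof -
  have bij: "bij \<pi>" and odd: "\<And>i. \<pi> (- i) = - \<pi> i"
    using assms by (auto simp: signed_perms_def permutes_bij)
  have "inv \<pi> (- i) = - inv \<pi> i" for i
    by (metis bij odd bij_inv_eq_iff)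
  then show ?thesis using assms by (auto simp: signed_perms_def permutes_inv)
qed

lemma signed_perms_Suc_iff:
  "\<sigma> \<in> signed_perms n \<longleftrightarrow> \<sigma> \<in> signed_perms (Suc n) \<and> \<sigma> (int n + 1) = int n + 1"
proof
  assume s: "\<sigma> \<in> signed_perms n"
  then have p: "\<sigma> permutes ({- int n..int n} - {0})" by (simp add: signed_perms_def)
  then have "\<sigma> (int n + 1) = int n + 1" by (rule permutes_not_in) simp
  moreover have "\<sigma> permutes ({- int (Suc n)..int (Suc n)} - {0})"
    by (rule permutes_subset[OF p]) auto
  ultimately show "\<sigma> \<in> signed_perms (Suc n) \<and> \<sigma> (int n + 1) = int n + 1"
    using s by (simp add: signed_perms_def)
next
  assume s: "\<sigma> \<in> signed_perms (Suc n) \<and> \<sigma> (int n + 1) = int n + 1"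
  then have p: "\<sigma> permutes ({- int (Suc n)..int (Suc n)} - {0})" and odd: "\<And>i. \<sigma> (- i) = - \<sigma> i"
    by (auto simp: signed_perms_def)
  have "\<sigma> permutes ({- int n..int n} - {0})"
  proof (rule permutes_superset[OF p])
    fix x assume "x \<in> {- int (Suc n)..int (Suc n)} - {0} - ({- int n..int n} - {0})"
    then have "x = int n + 1 \<or> x = - (int n + 1)" by auto
    then show "\<sigma> x = x" using s odd[of "int n + 1"] by auto
  qed
  then show "\<sigma> \<in> signed_perms n" using odd by (simp add: signed_perms_def)
qed

definition append_letter :: "nat \<Rightarrow> (int \<Rightarrow> int) \<Rightarrow> int \<Rightarrow> int \<Rightarrow> int" where
  "append_letter n \<sigma> v = make_room n v \<circ> \<sigma>"

lemma append_letter_last: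
  assumes "\<sigma> \<in> signed_perms n"
  shows "append_letter n \<sigma> v (int n + 1) = v"
  using assms signed_perms_Suc_iff[of \<sigma> n] by (simp add: append_letter_def make_room_def)

lemma make_room_less_iff:
  "\<bar>y\<bar> \<le> int n \<Longrightarrow> \<bar>z\<bar> \<le> int n \<Longrightarrow> make_room n v y < make_room n v z \<longleftrightarrow> y < z"
  by (auto simp: make_room_def sgn_if)

text \<open>
  The letter \<open>v\<close> is recovered as the last one, and \<open>\<sigma>\<close> by composing with the inverse of
  \<open>make_room n v\<close>, which leaves a signed permutation that fixes \<open>n + 1\<close>.
\<close>

lemma bij_betw_append_letter:
  assumes n: "n \<ge> 1"
  shows "bij_betw (\<lambda>(\<sigma>, v). append_letter n \<sigma> v) (up_signed_perms n \<times> last_letters n)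
           (up_signed_perms (Suc n))"
proof (rule bij_betw_imageI)
  note room = make_room_in_signed_perms[of _ n]
  have up_iff: "append_letter n \<sigma> v 1 > 0 \<longleftrightarrow> \<sigma> 1 > 0" if "\<sigma> \<in> signed_perms n" "v \<in> last_letters n" for \<sigma> v
    using make_room_less_iff[of 0 n "\<sigma> 1" v] signed_perms_range[OF that(1), of 1] n that(2)
    by (auto simp: append_letter_def make_room_def last_letters_def)
  show "inj_on (\<lambda>(\<sigma>, v). append_letter n \<sigma> v) (up_signed_perms n \<times> last_letters n)"
  proof (rule inj_onI, clarify)
    fix \<sigma> v \<tau> w
    assume mem: "\<sigma> \<in> up_signed_perms n" "\<tau> \<in> up_signed_perms n"
      "v \<in> last_letters n" "w \<in> last_letters n"
      and eq: "append_letter n \<sigma> v = append_letter n \<tau> w"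
    then have "v = w"
      using append_letter_last[of \<sigma> n v] append_letter_last[of \<tau> n w] by (simp add: up_signed_perms_def)
    moreover from this have "\<sigma> = \<tau>"
      using eq signed_perms_inj[OF room[OF mem(3)]]
      by (metis append_letter_def fun.inj_map_strong injD)
    ultimately show "\<sigma> = \<tau> \<and> v = w" by simp
  qed
  show "(\<lambda>(\<sigma>, v). append_letter n \<sigma> v) ` (up_signed_perms n \<times> last_letters n) = up_signed_perms (Suc n)"
  proof (intro equalityI subsetI)
    fix \<pi> assume "\<pi> \<in> (\<lambda>(\<sigma>, v). append_letter n \<sigma> v) ` (up_signed_perms n \<times> last_letters n)"
    then obtain \<sigma> v where "\<sigma> \<in> up_signed_perms n" "v \<in> last_letters n" "\<pi> = append_letter n \<sigma> v"
      by auto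
    then show "\<pi> \<in> up_signed_perms (Suc n)"
      using room[of v] up_iff[of \<sigma> v] signed_perms_Suc_iff[of \<sigma> n]
      by (auto simp: up_signed_perms_def append_letter_def intro: signed_perms_compose)
  next
    fix \<pi> assume pi: "\<pi> \<in> up_signed_perms (Suc n)"
    define v where "v = \<pi> (int n + 1)"
    define \<sigma> where "\<sigma> = inv (make_room n v) \<circ> \<pi>"
    have v: "v \<in> last_letters n"
      using signed_perms_range[of \<pi> "Suc n" "int n + 1"] pi
      by (auto simp: v_def last_letters_def up_signed_perms_def)
    have inj: "inj (make_room n v)" and surj: "surj (make_room n v)"
      using room[OF v] by (auto simp: signed_perms_def permutes_inj permutes_surj)
    have "make_room n v (int n + 1) = v" by (simp add: make_room_def)
    then have "\<sigma> (int n + 1) = int n + 1"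
      using inv_f_f[OF inj, of "int n + 1"] by (simp add: \<sigma>_def v_def)
    moreover have "\<sigma> \<in> signed_perms (Suc n)"
      unfolding \<sigma>_def using pi
      by (intro signed_perms_compose signed_perms_inv room v) (simp add: up_signed_perms_def)
    ultimately have sig: "\<sigma> \<in> signed_perms n" 
      using signed_perms_Suc_iff[of \<sigma> n] by simp
    have eq: "append_letter n \<sigma> v = \<pi>"
      using surj by (simp add: append_letter_def \<sigma>_def fun_eq_iff surj_f_inv_f)
    have "\<sigma> \<in> up_signed_perms n"
      using up_iff[OF sig v] sig pi by (simp add: eq up_signed_perms_def)
    then show "\<pi> \<in> (\<lambda>(\<sigma>, v). append_letter n \<sigma> v) ` (up_signed_perms n \<times> last_letters n)"
      using v eq by force
  qed
qed

section \<open>Refinement by the absolute value of the last letter\<close>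

definition aligned :: "nat \<Rightarrow> (int \<Rightarrow> int) \<Rightarrow> bool" where
  "aligned n \<pi> \<longleftrightarrow> (ascent \<pi> (int n) \<longleftrightarrow> 0 < \<pi> (int n))"

text \<open>
  In the notation of the introduction, \<open>layer n a True\<close> is \<open>H\<^sub>n(a)\<close> and \<open>layer n a False\<close> is \<open>K\<^sub>n(a)\<close>.
\<close>

definition layer :: "nat \<Rightarrow> nat \<Rightarrow> bool \<Rightarrow> real poly" where
  "layer n a b = (\<Sum>\<pi>\<in>up_signed_perms n.
     if \<bar>\<pi> (int n)\<bar> = int a \<and> aligned n \<pi> = b then run_weight n \<pi> else 0)"

lemma ascent_append_letter:
  assumes "\<sigma> \<in> signed_perms n" "1 \<le> k" "k \<le> int n"
  shows "ascent (append_letter n \<sigma> v) k = ascent \<sigma> k"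
proof -
  have "\<bar>\<sigma> i\<bar> \<le> int n" if "0 \<le> i" "i \<le> int n" for i
    using that signed_perms_range[OF assms(1), of i] assms(1)
    by (cases "i = 0") (auto simp: signed_perms_def permutes_def)
  from this[of k] this[of "k - 1"] show ?thesis
    using assms by (simp add: ascent_def append_letter_def make_room_less_iff)
qed

text \<open>
  If \<open>v\<close> is larger in absolute value than the letter before it, its sign decides the direction
  of the new step. Otherwise the step leads back towards zero, whichever sign \<open>v\<close> has.
\<close>

lemma ascent_append_letter_last:
  assumes "\<sigma> \<in> signed_perms n" "n \<ge> 1" "v \<in> last_letters n"
  shows "ascent (append_letter n \<sigma> v) (int n + 1) =
    (if \<bar>\<sigma> (int n)\<bar> < \<bar>v\<bar> then 0 < v else \<sigma> (int n) < 0)"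
  using signed_perms_range[OF assms(1), of "int n"] assms append_letter_last[OF assms(1), of v]
  by (auto simp: ascent_def append_letter_def make_room_def last_letters_def sgn_if)

lemma run_weight_append_letter:
  assumes "\<sigma> \<in> signed_perms n" "n \<ge> 1"
  shows "run_weight (Suc n) (append_letter n \<sigma> v) = run_weight n \<sigma> *
    (if ascent \<sigma> (int n) = ascent (append_letter n \<sigma> v) (int n + 1) then 1 else [:0, 1:])"
  using card_run_ends_Suc[OF assms(2), of "append_letter n \<sigma> v" \<sigma>] ascent_append_letter[OF assms(1)] assms(2)
  by (simp add: run_weight_def mult.commute)

text \<open>
  Both signs of a last letter of absolute value \<open>a\<close> are added up here. Outwards steps with the
  two signs go in opposite directions, so one of them starts a new run, which gives \<open>1 + x\<close>.
  An inwards step has the same direction for both signs, and just one sign makes it aligned;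
  it starts a new run exactly if the previous step went outwards.
\<close>

lemma layer_Suc:
  assumes n: "n \<ge> 1" and a: "1 \<le> a" "a \<le> Suc n"
  shows "layer (Suc n) a b = (\<Sum>\<sigma>\<in>up_signed_perms n. run_weight n \<sigma> *
    (if \<bar>\<sigma> (int n)\<bar> < int a then (if b then [:1, 1:] else 0)
     else if aligned n \<sigma> then [:0, 1:] else 1))"
proof -
  let ?f = "\<lambda>\<pi>. if \<bar>\<pi> (int (Suc n))\<bar> = int a \<and> aligned (Suc n) \<pi> = b then run_weight (Suc n) \<pi> else 0"
  have "layer (Suc n) a b = (\<Sum>(\<sigma>, v)\<in>up_signed_perms n \<times> last_letters n. ?f (append_letter n \<sigma> v))"
    unfolding layer_def sum.reindex_bij_betw[OF bij_betw_append_letter[OF n], symmetric]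
    by (rule sum.cong) auto
  also have "\<dots> = (\<Sum>\<sigma>\<in>up_signed_perms n. \<Sum>v\<in>last_letters n. ?f (append_letter n \<sigma> v))"
    by (simp add: sum.cartesian_product)
  also have "\<dots> = (\<Sum>\<sigma>\<in>up_signed_perms n. run_weight n \<sigma> *
    (if \<bar>\<sigma> (int n)\<bar> < int a then (if b then [:1, 1:] else 0)
     else if aligned n \<sigma> then [:0, 1:] else 1))"
  proof (rule sum.cong[OF refl])
    fix \<sigma> assume "\<sigma> \<in> up_signed_perms n"
    then have sig: "\<sigma> \<in> signed_perms n" by (simp add: up_signed_perms_def)
    have nz: "\<sigma> (int n) \<noteq> 0" using signed_perms_range[OF sig, of "int n"] n by simp
    have sub: "{int a, - int a} \<subseteq> last_letters n" using a by (auto simp: last_letters_def)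
    have last: "append_letter n \<sigma> v (int (Suc n)) = v" for v
      using append_letter_last[OF sig, of v] by (simp add: add.commute)
    have "(\<Sum>v\<in>last_letters n. ?f (append_letter n \<sigma> v)) = (\<Sum>v\<in>{int a, - int a}. ?f (append_letter n \<sigma> v))"
      unfolding last
      by (rule sum.mono_neutral_right[OF _ sub]) (auto simp: last_letters_def abs_if split: if_splits)
    also have "\<dots> = ?f (append_letter n \<sigma> (int a)) + ?f (append_letter n \<sigma> (- int a))"
      using a by simp
    also have "\<dots> = run_weight n \<sigma> *
    (if \<bar>\<sigma> (int n)\<bar> < int a then (if b then [:1, 1:] else 0)
     else if aligned n \<sigma> then [:0, 1:] else 1)"
    proof -
      have one: "[:1, 1:] = 1 + ([:0, 1:] :: real poly)" by (simp add: one_pCons)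
      have asc: "ascent (append_letter n \<sigma> (int a)) (int n + 1) =
          (if \<bar>\<sigma> (int n)\<bar> < int a then True else \<sigma> (int n) < 0)"
        "ascent (append_letter n \<sigma> (- int a)) (int n + 1) =
          (if \<bar>\<sigma> (int n)\<bar> < int a then False else \<sigma> (int n) < 0)"
        using ascent_append_letter_last[OF sig n, of "int a"]
          ascent_append_letter_last[OF sig n, of "- int a"] sub a by auto
      have Suc: "int (Suc n) = int n + 1" by simp
      show ?thesis
        using a nz
        unfolding one aligned_def last run_weight_append_letter[OF sig n] Suc asc
          append_letter_last[OF sig]
        by (auto simp: algebra_simps)
    qed
    finally show "(\<Sum>v\<in>last_letters n. ?f (append_letter n \<sigma> v)) = run_weight n \<sigma> *
    (if \<bar>\<sigma> (int n)\<bar> < int a then (if b then [:1, 1:] else 0)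
     else if aligned n \<sigma> then [:0, 1:] else 1)" .
  qed
  finally show ?thesis .
qed

text \<open>Every earlier letter has smaller absolute value, so all steps to the top letter go outwards.\<close>

lemma layer_top_eq_run_poly:
  assumes n: "n \<ge> 1"
  shows "layer (Suc n) (Suc n) True = [:1, 1:] * run_poly n" "layer (Suc n) (Suc n) False = 0"
proof -
  have lt: "\<bar>\<sigma> (int n)\<bar> < int (Suc n)" if "\<sigma> \<in> up_signed_perms n" for \<sigma>
    using that signed_perms_range(2)[of \<sigma> n "int n"] n by (simp add: up_signed_perms_def)
  show "layer (Suc n) (Suc n) True = [:1, 1:] * run_poly n"
    using lt by (auto simp: layer_Suc[OF n] run_poly_eq_sum_weight[OF n] sum_distrib_right mult.commute[of "[:1, 1:]"]
      simp del: mult_pCons_left mult_pCons_right intro!: sum.cong)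
  show "layer (Suc n) (Suc n) False = 0"
    using lt by (auto simp: layer_Suc[OF n] intro!: sum.neutral)
qed

text \<open>A step to \<open>1\<close> or \<open>-1\<close> goes inwards, for which both kinds have the same weight.\<close>

lemma layer_bottom:
  assumes n: "n \<ge> 1"
  shows "layer (Suc n) 1 True = layer (Suc n) 1 False"
proof -
  have "\<not> \<bar>\<sigma> (int n)\<bar> < int 1" if "\<sigma> \<in> up_signed_perms n" for \<sigma>
    using that signed_perms_range(1)[of \<sigma> n "int n"] n by (simp add: up_signed_perms_def)
  then show ?thesis by (auto simp: layer_Suc[OF n] intro!: sum.cong)
qed

text \<open>
  In the recurrence, passing from \<open>a\<close> to \<open>a + 1\<close> only affects the permutations of size \<open>n\<close> whose
  last letter has absolute value \<open>a\<close>: the step from it turns from inwards to outwards.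
\<close>

lemma layer_step:
  assumes n: "n \<ge> 1" and a: "1 \<le> a" "a \<le> n"
  shows "layer (Suc n) (Suc a) True =
      layer (Suc n) a True + layer n a True + [:0, 1:] * layer n a False"
    and "layer (Suc n) (Suc a) False =
      layer (Suc n) a False - [:0, 1:] * layer n a True - layer n a False"
proof -
  have one: "[:1, 1:] = 1 + ([:0, 1:] :: real poly)" by (simp add: one_pCons)
  show "layer (Suc n) (Suc a) True =
      layer (Suc n) a True + layer n a True + [:0, 1:] * layer n a False"
    using a unfolding layer_def[of n] one
    by (simp add: layer_Suc n sum_distrib_left flip: sum.distrib)
       (rule sum.cong, auto simp: algebra_simps one)
  show "layer (Suc n) (Suc a) False =
      layer (Suc n) a False - [:0, 1:] * layer n a True - layer n a False"
    using a unfolding layer_def[of n]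
    by (simp add: layer_Suc n sum_distrib_left flip: sum_subtractf)
       (rule sum.cong, auto simp: algebra_simps)
qed

lemma layer_one:
  "layer 1 1 True = [:0, 1:]" "layer 1 1 False = 0"
proof -
  have "\<pi> = id" if "\<pi> \<in> up_signed_perms 1" for \<pi>
  proof -
    have \<pi>: "\<pi> \<in> signed_perms (Suc 0)" "0 < \<pi> 1"
      using that by (simp_all add: up_signed_perms_def)
    then have "\<pi> 1 = 1" using signed_perms_range[OF \<pi>(1), of 1] by simp
    then have "\<pi> \<in> signed_perms 0" using \<pi> signed_perms_Suc_iff[of \<pi> 0] by simp
    then show ?thesis by (simp add: signed_perms_def)
  qed
  moreover have "id \<in> up_signed_perms 1"
    by (simp add: up_signed_perms_def signed_perms_def permutes_id)
  ultimately have "up_signed_perms 1 = {id}" by auto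
  moreover have "run_ends 1 id = {1}" by (auto simp: run_ends_def)
  ultimately show "layer 1 1 True = [:0, 1:]" "layer 1 1 False = 0"
    by (simp_all add: layer_def aligned_def ascent_def run_weight_def)
qed

section \<open>The convolution identity\<close>

text \<open>
  A step either raises \<open>a\<close> or raises \<open>j\<close> and lowers \<open>n\<close>. Both reduce \<open>n - a\<close> by one, so \<open>d\<close> steps
  lead from \<open>(a + d, a)\<close> to the diagonal, and the binomial coefficient counts the ways in which
  \<open>i\<close> of them raise \<open>j\<close>.
\<close>

lemma backward_difference_sum:
  fixes F :: "nat \<Rightarrow> nat \<Rightarrow> nat \<Rightarrow> 'a :: comm_semiring_1"
  assumes step: "\<And>j n a. 1 \<le> a \<Longrightarrow> a \<le> n \<Longrightarrow> F j (Suc n) a = F j (Suc n) (Suc a) + F (Suc j) n a"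
    and a: "1 \<le> a"
  shows "F j (a + d) a = (\<Sum>i\<le>d. of_nat (d choose i) * F (j + i) (a + d - i) (a + d - i))"
  using a
proof (induction d arbitrary: j a)
  case (Suc d)
  let ?G = "\<lambda>i. F (j + i) (a + Suc d - i) (a + Suc d - i)"
  have "F j (a + Suc d) a = F j (Suc a + d) (Suc a) + F (Suc j) (a + d) a"
    using step[of a "a + d" j] Suc.prems by simp
  also have "F j (Suc a + d) (Suc a) = (\<Sum>i\<le>d. of_nat (d choose i) * ?G i)"
    using Suc.IH[of "Suc a" j] by simp
  also have "F (Suc j) (a + d) a = (\<Sum>i\<le>d. of_nat (d choose i) * ?G (Suc i))"
    using Suc.IH[of a "Suc j"] Suc.prems by simp
  also have "(\<Sum>i\<le>d. of_nat (d choose i) * ?G i) = (\<Sum>i\<le>Suc d. of_nat (d choose i) * ?G i)"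
    by (simp add: binomial_eq_0)
  also have "\<dots> = ?G 0 + (\<Sum>i\<le>d. of_nat (d choose Suc i) * ?G (Suc i))"
    by (subst sum.atMost_Suc_shift) simp
  also have "\<dots> + (\<Sum>i\<le>d. of_nat (d choose i) * ?G (Suc i)) =
      ?G 0 + (\<Sum>i\<le>d. of_nat (Suc d choose Suc i) * ?G (Suc i))"
    by (simp add: sum.distrib algebra_simps)
  also have "\<dots> = (\<Sum>i\<le>Suc d. of_nat (Suc d choose i) * ?G i)"
    by (subst sum.atMost_Suc_shift) simp
  finally show ?case .
qed simp

lemma t_poly_0: "t_poly 0 = - 1"
  by (simp add: t_poly_def)

text \<open>
  This is what makes \<open>(-t\<^sub>j, (-1)\<^sup>j t\<^sub>j)\<close> equal to the row vector \<open>(1, -1) (-M)\<^sup>j\<close> of the introduction.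
\<close>

lemma t_poly_Suc: "t_poly (Suc j) = - (1 + (- 1) ^ j * [:0, 1:]) * t_poly j"
proof -
  define X :: "real poly" where "X = [:0, 1:]"
  have "[:1, 1:] = 1 + X" by (simp add: X_def one_pCons)
  then have t_poly: "t_poly i = (if odd i then (1 + X) * (1 - X\<^sup>2) ^ (i div 2)
      else - ((1 - X\<^sup>2) ^ (i div 2)))" for i
    by (simp only: t_poly_def X_def)
  show ?thesis
  proof (cases "even j")
    case True
    then show ?thesis unfolding X_def[symmetric] t_poly by (simp add: algebra_simps)
  next
    case False
    then obtain k where "j = Suc (2 * k)" by (metis oddE Suc_eq_plus1)
    then show ?thesis unfolding X_def[symmetric] t_poly by (simp add: algebra_simps power2_eq_square)
  qed
qed

text \<open>
  The value \<open>x\<close> at \<open>0\<close> stands for \<open>(1 + x) T\<^sub>0\<close> with \<open>T\<^sub>0 = x / (1 + x)\<close>: it is the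
  aligned weight at the top for \<open>n = 1\<close> (see \<open>layer_top\<close>), and it
  produces the fractional summand of the theorem.
\<close>

definition top_layer :: "nat \<Rightarrow> real poly" where
  "top_layer n = (if n = 0 then [:0, 1:] else [:1, 1:] * run_poly n)"

lemma layer_top:
  "layer (Suc m) (Suc m) True = top_layer m" "layer (Suc m) (Suc m) False = 0"
  using layer_one layer_top_eq_run_poly[of m] by (cases m; simp add: top_layer_def)+

text \<open>
  The functional \<open>F\<close> below is \<open>(1, -1) (-M)\<^sup>j\<close> applied to \<open>(H, K)\<close>. It vanishes at \<open>a = 1\<close>, \<open>j = 0\<close>,
  and iterating its difference equation up to the diagonal yields the identity.
\<close>

lemma top_layer_convolution:
  assumes "n \<ge> 1"
  shows "top_layer n = (\<Sum>i<n. of_nat (n choose i) * t_poly (n - i) * top_layer i)"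
proof -
  define F where "F j n a = - t_poly j * layer n a True + (- 1) ^ j * t_poly j * layer n a False" for j n a
  have step: "F j (Suc n) a = F j (Suc n) (Suc a) + F (Suc j) n a" if "1 \<le> a" "a \<le> n" for j n a
  proof (cases "even j")
    case True
    then show ?thesis using that by (simp add: F_def layer_step t_poly_Suc algebra_simps)
  next
    case False
    then show ?thesis using that by (simp add: F_def layer_step t_poly_Suc algebra_simps)
  qed
  have corner: "F j (Suc m) (Suc m) = - t_poly j * top_layer m" for j m
    by (simp add: F_def layer_top)
  have "0 = F 0 (1 + n) 1"
    using layer_bottom[OF assms] by (simp add: F_def)
  also have "\<dots> = (\<Sum>i\<le>n. of_nat (n choose i) * F i (1 + n - i) (1 + n - i))"
    using backward_difference_sum[of F 1 0 n] step by simp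
  also have "\<dots> = (\<Sum>i\<le>n. - (of_nat (n choose i) * t_poly i * top_layer (n - i)))"
    by (rule sum.cong) (auto simp: Suc_diff_le corner)
  also have "\<dots> = (\<Sum>i\<le>n. - (of_nat (n choose i) * t_poly (n - i) * top_layer i))"
    by (subst sum.nat_diff_reindex[symmetric, where n = "Suc n", simplified lessThan_Suc_atMost])
       (auto intro!: sum.cong simp: binomial_symmetric[symmetric])
  also have "\<dots> = top_layer n - (\<Sum>i<n. of_nat (n choose i) * t_poly (n - i) * top_layer i)"
    by (simp add: lessThan_Suc_atMost[symmetric] t_poly_0 sum_negf)
  finally show ?thesis by simp
qed

section \<open>The multiplicity of the zero \<open>-1\<close>\<close>

lemma even_binomial:
  assumes "even n" "odd i"
  shows "even (n choose i)"
proof -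
  obtain k where "i = Suc k" using assms(2) by (cases i) auto
  then have "i * (n choose i) = n * ((n - 1) choose k)"
    by (simp only: binomial_absorption)
  then show ?thesis using assms by (metis even_mult_iff)
qed

lemma t_poly_factor:
  "t_poly m = [:1, 1:] ^ ((m + 1) div 2) *
     ((if odd m then 1 else - 1) * [:1, - 1:] ^ (m div 2))"
proof -
  define u v :: "real poly" where "u = [:1, 1:]" and "v = [:1, - 1:]"
  have "1 - [:0, 1:] ^ 2 = u * v"
    by (simp add: u_def v_def power2_eq_square one_pCons)
  then have "t_poly m = (if odd m then u * (u * v) ^ (m div 2) else - ((u * v) ^ (m div 2)))"
    by (simp only: t_poly_def u_def)
  moreover have "(m + 1) div 2 = (if odd m then Suc (m div 2) else m div 2)"
    by presburger
  ultimately show ?thesis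
    unfolding u_def[symmetric] v_def[symmetric] by (simp add: power_mult_distrib mult.assoc)
qed

lemma half_add_half:
  fixes d i :: nat
  shows "(d + 1) div 2 + (i + 1) div 2 = (d + i + 1) div 2 + (if odd d \<and> odd i then 1 else 0)"
    and "(odd d \<and> odd i) \<or> d div 2 + i div 2 = (d + i) div 2"
  by (cases "even d"; cases "even i"; auto elim!: evenE oddE)+

text \<open>
  Induction with the convolution: the rounded exponents \<open>\<lceil>(n - i)/2\<rceil>\<close> and \<open>\<lceil>i/2\<rceil>\<close> add up to \<open>\<lceil>n/2\<rceil>\<close>,
  except when \<open>n\<close> is even and \<open>i\<close> is odd; then a factor \<open>1 + x\<close> is left over and the summand
  is lost at \<open>-1\<close>. The odd part \<open>c\<close> is needed to see that the remaining alternating sum does not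
  vanish: modulo two, signs and odd factors disappear, and so do the lost summands, since their
  binomial coefficients are even.
\<close>

lemma top_layer_factor:
  "\<exists>R c. top_layer n = [:1, 1:] ^ ((n + 1) div 2) * R \<and>
     poly R (- 1) = 2 ^ (n div 2) * of_int c \<and> odd c"
proof (induction n rule: less_induct)
  case (less n)
  show ?case
  proof (cases "n = 0")
    case True
    then show ?thesis
      by (intro exI[of _ "[:0, 1:]"] exI[of _ "- 1"]) (simp add: top_layer_def)
  next
    case False
    obtain R c where R: "\<And>i. i < n \<Longrightarrow> top_layer i = [:1, 1:] ^ ((i + 1) div 2) * R i"
      and val: "\<And>i. i < n \<Longrightarrow> poly (R i) (- 1) = 2 ^ (i div 2) * of_int (c i)"
      and odd_c: "\<And>i. i < n \<Longrightarrow> odd (c i)"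
      using less.IH by metis
    define lost where "lost i \<longleftrightarrow> even n \<and> odd i" for i :: nat
    define q :: "nat \<Rightarrow> real poly" where
      "q i = (if lost i then [:1, 1:] else 1) *
         ((if odd (n - i) then 1 else - 1) * [:1, - 1:] ^ ((n - i) div 2))" for i
    define R' where "R' = (\<Sum>i<n. of_nat (n choose i) * q i * R i)"
    define e where "e i = (if lost i then 0 else if odd (n - i) then 1 else - 1 :: int)" for i
    define c' where "c' = (\<Sum>i<n. int (n choose i) * e i * c i)"
    have halves: "(n - i + 1) div 2 + (i + 1) div 2 = (n + 1) div 2 + (if lost i then 1 else 0)"
      "lost i \<or> (n - i) div 2 + i div 2 = n div 2" if "i < n" for i
      using half_add_half[of "n - i" i] that by (auto simp: lost_def)
    have "top_layer n = (\<Sum>i<n. of_nat (n choose i) * t_poly (n - i) * top_layer i)"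
      using False by (intro top_layer_convolution) simp
    also have "\<dots> = [:1, 1:] ^ ((n + 1) div 2) * R'"
      unfolding R'_def sum_distrib_left
    proof (rule sum.cong[OF refl])
      fix i assume "i \<in> {..<n}"
      then have i: "i < n" by simp
      define s :: "real poly" where "s = (if odd (n - i) then 1 else - 1) * [:1, - 1:] ^ ((n - i) div 2)"
      define u :: "real poly" where "u = [:1, 1:]"
      have "t_poly (n - i) * top_layer i = u ^ ((n - i + 1) div 2 + (i + 1) div 2) * s * R i"
        unfolding t_poly_factor R[OF i] s_def u_def power_add by (simp only: mult_ac)
      also have "\<dots> = u ^ ((n + 1) div 2) * (q i * R i)"
        unfolding halves(1)[OF i] q_def s_def[symmetric] u_def[symmetric] by (simp add: algebra_simps)
      finally have "of_nat (n choose i) * (t_poly (n - i) * top_layer i) =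
          of_nat (n choose i) * (u ^ ((n + 1) div 2) * (q i * R i))"
        by (rule arg_cong)
      then show "of_nat (n choose i) * t_poly (n - i) * top_layer i =
          [:1, 1:] ^ ((n + 1) div 2) * (of_nat (n choose i) * q i * R i)"
        unfolding u_def by (simp only: mult_ac)
    qed
    finally have factor: "top_layer n = [:1, 1:] ^ ((n + 1) div 2) * R'" .
    have "poly R' (- 1) = (\<Sum>i<n. real (n choose i) * poly (q i) (- 1) * (2 ^ (i div 2) * of_int (c i)))"
      by (simp add: R'_def poly_sum val)
    also have "\<dots> = (\<Sum>i<n. 2 ^ (n div 2) * of_int (int (n choose i) * e i * c i))"
    proof (rule sum.cong[OF refl])
      fix i assume "i \<in> {..<n}"
      then have i: "i < n" by simp
      show "real (n choose i) * poly (q i) (- 1) * (2 ^ (i div 2) * of_int (c i)) =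
          2 ^ (n div 2) * of_int (int (n choose i) * e i * c i)"
      proof (cases "lost i")
        case True
        then show ?thesis by (simp add: q_def e_def)
      next
        case False
        then have "(2 :: real) ^ (n div 2) = 2 ^ ((n - i) div 2) * 2 ^ (i div 2)"
          using halves(2)[OF i] by (simp flip: power_add)
        then show ?thesis using False by (simp add: q_def e_def)
      qed
    qed
    also have "\<dots> = 2 ^ (n div 2) * of_int c'"
      by (simp add: c'_def sum_distrib_left)
    finally have at_minus_one: "poly R' (- 1) = 2 ^ (n div 2) * of_int c'" .
    have "2 dvd (\<Sum>i<n. int (n choose i) * e i * c i - int (n choose i))"
    proof (rule dvd_sum)
      fix i assume "i \<in> {..<n}"
      then show "2 dvd int (n choose i) * e i * c i - int (n choose i)"
        using odd_c[of i] even_binomial[of n i] by (auto simp: e_def lost_def)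
    qed
    moreover define N where "N = (\<Sum>i<n. n choose i)"
    ultimately have "even (c' - int N)"
      by (simp add: c'_def sum_subtractf)
    moreover have "N + 1 = 2 ^ n"
      using choose_row_sum[of n] by (simp add: N_def lessThan_Suc_atMost[symmetric])
    then have "odd N"
      using False by (metis even_plus_one_iff even_power even_numeral neq0_conv)
    ultimately have "odd c'" by auto
    then show ?thesis using factor at_minus_one by blast
  qed
qed

text \<open>
  The exponent is \<open>\<lceil>n/2\<rceil> - 1\<close>, one factor \<open>1 + x\<close> of \<open>top_layer n\<close> being the one that multiplies
  the run polynomial.
\<close>

lemma order_run_poly:
  assumes "n \<ge> 1"
  shows "order (- 1) (run_poly n) = (n - 1) div 2"
proof -
  obtain R c where R: "[:1, 1:] * run_poly n = [:1, 1:] ^ ((n + 1) div 2) * R"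
    and val: "poly R (- 1) = 2 ^ (n div 2) * of_int c" "odd c"
    using top_layer_factor[of n] assms by (auto simp: top_layer_def)
  have nz: "poly R (- 1) \<noteq> 0" using val by auto
  have "(n + 1) div 2 = Suc ((n - 1) div 2)" using assms by presburger
  then have "[:1, 1:] * run_poly n = [:1, 1:] * ([:1, 1:] ^ ((n - 1) div 2) * R)"
    using R by (simp only: power_Suc mult.assoc)
  then have eq: "run_poly n = [:- (- 1), 1:] ^ ((n - 1) div 2) * R"
    by (subst (asm) mult_left_cancel) simp_all
  have "[:- (- 1), 1:] ^ ((n - 1) div 2) * R \<noteq> 0" using nz by auto
  then have "order (- 1) (run_poly n) =
      order (- 1) ([:- (- 1), 1 :: real:] ^ ((n - 1) div 2)) + order (- 1) R"
    unfolding eq by (rule order_mult)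
  then show ?thesis
    unfolding order_power_n_n using nz by (simp add: order_0I)
qed

theorem corollary17:
  fixes n :: nat
  assumes "n \<ge> 1"
  shows "to_fract (run_poly n) =
           to_fract [:0, 1:] / to_fract [:1, 1:] * to_fract (t_poly n) +
           to_fract (\<Sum>r=2..n. of_nat (n choose (r - 1)) * t_poly (n - r + 1) * run_poly (r - 1))
       \<and> order (- 1) (run_poly n) = nat \<lfloor>(real n - 1) / 2\<rfloor>"
proof
  define S where "S = (\<Sum>r=2..n. of_nat (n choose (r - 1)) * t_poly (n - r + 1) * run_poly (r - 1))"
  obtain m where m: "n = Suc m" using assms by (cases n) auto
  \<comment> \<open>the summation index \<open>i = r - 1\<close> matches the convolution, whose summand \<open>i = 0\<close> is the fraction\<close>
  have "S = (\<Sum>i=1..m. of_nat (n choose i) * t_poly (n - i) * run_poly i)"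
    unfolding S_def m numeral_2_eq_2 sum.shift_bounds_cl_Suc_ivl
    by (rule sum.cong) (auto simp: Suc_diff_le)
  then have "[:1, 1:] * S = (\<Sum>i=1..m. of_nat (n choose i) * t_poly (n - i) * top_layer i)"
    by (auto simp: sum_distrib_left top_layer_def mult_ac
      simp del: mult_pCons_left mult_pCons_right intro!: sum.cong)
  moreover have "{..<n} = insert 0 {1..m}" using m by auto
  ultimately have "top_layer n = [:0, 1:] * t_poly n + [:1, 1:] * S"
    using top_layer_convolution[OF assms] by (simp add: top_layer_def)
  then have "[:1, 1:] * run_poly n = [:0, 1:] * t_poly n + [:1, 1:] * S"
    using assms by (simp add: top_layer_def)
  then have "to_fract [:1, 1:] * to_fract (run_poly n) =
      to_fract [:0, 1:] * to_fract (t_poly n) + to_fract [:1, 1:] * to_fract S"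
    by (metis to_fract_add to_fract_mult)
  moreover have "to_fract ([:1, 1:] :: real poly) \<noteq> 0" by simp
  ultimately show "to_fract (run_poly n) = to_fract [:0, 1:] / to_fract [:1, 1:] * to_fract (t_poly n) +
      to_fract (\<Sum>r=2..n. of_nat (n choose (r - 1)) * t_poly (n - r + 1) * run_poly (r - 1))"
    unfolding S_def[symmetric] by (simp add: field_simps)
  have "\<lfloor>(real n - 1) / 2\<rfloor> = int ((n - 1) div 2)"
    using floor_divide_of_nat_eq[of "n - 1" 2, where ?'a = real] assms by (simp add: of_nat_diff)
  then show "order (- 1) (run_poly n) = nat \<lfloor>(real n - 1) / 2\<rfloor>"
    using order_run_poly[OF assms] by simp
qed

end
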